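(* For an integer $N\ge 2$ put $h_j=\sin^2\!\big(\frac{\pi j}{2N}\big)$, $0\le j\le N$. The equation $$\sum_{j=0}^{N-1}\frac{h_{j+1}-h_j}{\frac12\Big(\sqrt{\psi_\lambda(h_j)}+\sqrt{\psi_\lambda(h_{j+1})}\Big)}=1$$ in the unknown real number $\lambda>0$ (among those $\lambda$ for which the left-hand side is defined, i.e. $\psi_\lambda(h_j)\ge 0$ for all $j$ and no denominator vanishes) has a unique solution $\lambda^N$, and $\lambda^N$ converges to $\lambda_*$ as $N\to\infty$.
   Context: $\Sigma:[0,1]\to\mathbb{R}$ is a continuous function with $\Sigma(h)\ge\Sigma_*>0$ for all $h\in[0,1]$, for some constant $\Sigma_*$. For $\lambda>0$, $\psi_\lambda$ is the solution of $\psi_\lambda''(h)=2-2\lambda\Sigma(h)$ on $[0,1]$, $\psi_\lambda(0)=\psi_\lambda(1)=0$. The number $\lambda_*$ is the exact value of $\lambda$ in the coupled problem: find $(\lambda,h,\varphi)$ with $-\varphi''(z)+\varphi(z)=\lambda\,\Sigma(h(z))\,\varphi(z)$, $h'(z)=\varphi(z)$ for $0<z<1$, $h(0)=0$, $h(1)=1$, $\varphi(0)=\varphi(1)=0$, $\lambda\ge0$, $\varphi(z)>0$ for $0<z<1$. It is known that this problem has a unique solution $(\lambda_*,h_*,\varphi_* )$, and that $\lambda_*$ is the unique $\lambda>0$ such that $\int_0^1\frac{dh}{\sqrt{\psi_\lambda(h)}}=1$. *)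

theory Defs
  imports "HOL-Analysis.Analysis"
begin

definition solves_psi :: "(real \<Rightarrow> real) \<Rightarrow> real \<Rightarrow> (real \<Rightarrow> real) \<Rightarrow> bool" where
  "solves_psi Sig lam \<psi> \<longleftrightarrow>
     (\<exists>\<psi>'. \<forall>h\<in>{0..1}.
        (\<psi> has_real_derivative \<psi>' h) (at h within {0..1}) \<and>
        (\<psi>' has_real_derivative (2 - 2 * lam * Sig h)) (at h within {0..1})) \<and>
     \<psi> 0 = 0 \<and> \<psi> 1 = 0"

text \<open>Classical solutions: the equations hold pointwise on the open interval, and continuity on
  the closed interval gives the boundary conditions their meaning. Since \<open>h\<close> is increasing from
  \<open>0\<close> to \<open>1\<close>, only the values of \<open>Sig\<close> on the unit interval enter.\<close>

definition coupled_solution ::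
  "(real \<Rightarrow> real) \<Rightarrow> real \<Rightarrow> (real \<Rightarrow> real) \<Rightarrow> (real \<Rightarrow> real) \<Rightarrow> bool" where
  "coupled_solution Sig lam h \<phi> \<longleftrightarrow>
     lam \<ge> 0 \<and>
     continuous_on {0..1} h \<and> continuous_on {0..1} \<phi> \<and>
     (\<exists>\<phi>' \<phi>''. \<forall>z\<in>{0<..<1}.
        (\<phi> has_real_derivative \<phi>' z) (at z) \<and>
        (\<phi>' has_real_derivative \<phi>'' z) (at z) \<and>
        - \<phi>'' z + \<phi> z = lam * Sig (h z) * \<phi> z) \<and>
     (\<forall>z\<in>{0<..<1}. (h has_real_derivative \<phi> z) (at z)) \<and>
     h 0 = 0 \<and> h 1 = 1 \<and> \<phi> 0 = 0 \<and> \<phi> 1 = 0 \<and>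
     (\<forall>z\<in>{0<..<1}. \<phi> z > 0)"

definition node :: "nat \<Rightarrow> nat \<Rightarrow> real" where
  "node N j = (sin (pi * real j / (2 * real N)))\<^sup>2"

text \<open>In HOL, \<open>sqrt\<close> is total and \<open>x / 0 = 0\<close>, so the requirement that the
  left-hand side of the equation be defined is stated explicitly.\<close>

definition discrete_solution :: "(real \<Rightarrow> real \<Rightarrow> real) \<Rightarrow> nat \<Rightarrow> real \<Rightarrow> bool" where
  "discrete_solution \<psi> N lam \<longleftrightarrow>
     lam > 0 \<and>
     (\<forall>j\<le>N. \<psi> lam (node N j) \<ge> 0) \<and>
     (\<forall>j<N. (1/2) * (sqrt (\<psi> lam (node N j)) + sqrt (\<psi> lam (node N (Suc j)))) \<noteq> 0) \<and>
     (\<Sum>j<N. (node N (Suc j) - node N j) /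
        ((1/2) * (sqrt (\<psi> lam (node N j)) + sqrt (\<psi> lam (node N (Suc j)))))) = 1"

end

theory Submission
  imports Defs
begin

text \<open>By linearity \<open>\<psi>\<^sub>\<lambda> = \<lambda> G - w\<close> with \<open>w h = h (1 - h)\<close>, \<open>G'' = - 2 \<Sigma>\<close> and \<open>G\<close> strictly concave,
  so that \<open>\<psi>\<^sub>\<lambda> \<le> (\<lambda> / \<mu>) \<psi>\<^sub>\<mu>\<close> for \<open>\<lambda> \<le> \<mu>\<close> and the discrete sum satisfies
  \<open>F\<^sub>N(\<mu>) \<le> sqrt (\<lambda> / \<mu>) F\<^sub>N(\<lambda>)\<close>. This gives uniqueness, \<open>F\<^sub>N \<le> 1\<close> somewhere, and it traps the
  solution between \<open>\<lambda>\<^sub>*\<close> and \<open>\<lambda>\<^sub>* F\<^sub>N(\<lambda>\<^sub>*)\<^sup>2\<close>. Slightly above the smallest admissible \<open>\<lambda>\<close>, \<open>\<psi>\<^sub>\<lambda>\<close>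
  almost vanishes at some interior node \<open>k\<close>; concavity then gives \<open>F\<^sub>N \<ge> 1\<close> there, since
  \<open>sqrt k + sqrt (1 - k) > 1\<close>, and the intermediate value theorem yields existence.

  A coupled solution satisfies \<open>\<phi>\<^sup>2 = \<psi>(h)\<close> with \<open>\<psi> = w q\<^sup>2\<close> and \<open>q\<close> positive and continuous up to the
  end points. Under \<open>h = sin\<^sup>2 t\<close> each summand of \<open>F\<^sub>N(\<lambda>\<^sub>*)\<close> becomes exactly
  \<open>2 tan (\<pi> / (2 N))\<close> divided by a value of \<open>q (sin\<^sup>2 t)\<close>, so \<open>F\<^sub>N(\<lambda>\<^sub>*)\<close> is essentially a Riemann sum of
  \<open>2 / q (sin\<^sup>2 t)\<close> over \<open>[0, \<pi>/2]\<close>, and that integral is the travel time \<open>1\<close>.\<close>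

section \<open>Discrete sums for a general profile \<open>f\<close> and general nodes
  \<open>x\<close>\<close>

definition quad :: "(real \<Rightarrow> real) \<Rightarrow> (nat \<Rightarrow> real) \<Rightarrow> nat \<Rightarrow> real" where
  "quad f x N = (\<Sum>j<N. (x (Suc j) - x j) / ((1/2) * (sqrt (f (x j)) + sqrt (f (x (Suc j))))))"

definition admissible :: "(real \<Rightarrow> real) \<Rightarrow> (nat \<Rightarrow> real) \<Rightarrow> nat \<Rightarrow> bool" where
  "admissible f x N \<longleftrightarrow> (\<forall>j\<le>N. f (x j) \<ge> 0) \<and>
     (\<forall>j<N. (1/2) * (sqrt (f (x j)) + sqrt (f (x (Suc j)))) \<noteq> 0)"

lemma admissibleD:
  assumes "admissible f x N" "j < N"
  shows "sqrt (f (x j)) + sqrt (f (x (Suc j))) > 0"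
proof -
  have "f (x j) \<ge> 0" "f (x (Suc j)) \<ge> 0" "sqrt (f (x j)) + sqrt (f (x (Suc j))) \<noteq> 0"
    using assms by (auto simp: admissible_def)
  then show ?thesis
    using real_sqrt_ge_zero[of "f (x j)"] real_sqrt_ge_zero[of "f (x (Suc j))"] by linarith
qed

text \<open>With \<open>N >= 2\<close> every cell has an interior node as an end point, so each
  denominator contains a positive root.\<close>

lemma admissible_of_interior:
  assumes "N \<ge> 2" "f (x 0) = 0" "f (x N) = 0" "\<And>j. 0 < j \<Longrightarrow> j < N \<Longrightarrow> f (x j) > 0"
  shows "admissible f x N"
proof -
  have nonneg: "f (x j) \<ge> 0" if "j \<le> N" for j
    using assms that by (metis less_eq_real_def not_gr_zero order_le_less)
  moreover have "sqrt (f (x j)) + sqrt (f (x (Suc j))) > 0" if j: "j < N" for j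
  proof (cases "j = 0")
    case True
    then show ?thesis
      using assms(1,2) assms(4)[of 1] by simp
  next
    case False
    then have "f (x j) > 0" "f (x (Suc j)) \<ge> 0"
      using assms(4)[of j] nonneg[of "Suc j"] j by auto
    then show ?thesis
      by (simp add: add_pos_nonneg)
  qed
  ultimately show ?thesis
    unfolding admissible_def by force
qed

lemma quad_pos:
  assumes "admissible f x N" "N > 0" "\<And>j. j < N \<Longrightarrow> x j < x (Suc j)"
  shows "quad f x N > 0"
  unfolding quad_def
  by (rule sum_pos) (use assms admissibleD[OF assms(1)] in auto)

text \<open>Term by term: the bound at the nodes makes each denominator for \<open>f\<close> at most
  \<open>sqrt c\<close> times the one for \<open>g\<close>, and the increments of \<open>x\<close>
  are nonnegative.\<close>

lemma quad_scale:
  assumes f: "admissible f x N" and g: "admissible g x N"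
    and inc: "\<And>j. j < N \<Longrightarrow> x j \<le> x (Suc j)"
    and c: "c > 0" and le: "\<And>j. j \<le> N \<Longrightarrow> f (x j) \<le> c * g (x j)"
  shows "quad g x N \<le> sqrt c * quad f x N"
proof -
  have "(x (Suc j) - x j) / ((1/2) * (sqrt (g (x j)) + sqrt (g (x (Suc j)))))
      \<le> sqrt c * ((x (Suc j) - x j) / ((1/2) * (sqrt (f (x j)) + sqrt (f (x (Suc j))))))"
    if j: "j < N" for j
  proof -
    define a where "a = sqrt (f (x j)) + sqrt (f (x (Suc j)))"
    define b where "b = sqrt (g (x j)) + sqrt (g (x (Suc j)))"
    have pos: "a > 0" "b > 0"
      using admissibleD[OF f j] admissibleD[OF g j] by (auto simp: a_def b_def)
    \<comment> \<open>In HOL \<open>sqrt\<close> is monotone and multiplicative on all reals, so the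
      bound passes through the root directly.\<close>
    have "sqrt (f (x i)) \<le> sqrt c * sqrt (g (x i))" if "i \<le> N" for i
      using le[OF that] by (metis real_sqrt_le_iff real_sqrt_mult)
    from this[of j] this[of "Suc j"] have "a \<le> sqrt c * b"
      using j by (simp add: a_def b_def algebra_simps)
    then have "(x (Suc j) - x j) * a \<le> (x (Suc j) - x j) * (sqrt c * b)"
      using inc[OF j] by (intro mult_left_mono) auto
    then have "(x (Suc j) - x j) / (b/2) \<le> sqrt c * ((x (Suc j) - x j) / (a/2))"
      using pos by (simp add: field_simps)
    then show ?thesis
      by (simp add: a_def b_def)
  qed
  then show ?thesis
    unfolding quad_def sum_distrib_left by (intro sum_mono) auto
qed

section \<open>Concavity of \<open>G\<close> and the family \<open>P lam\<close>\<close>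

locale string_data =
  fixes Sig G G' :: "real \<Rightarrow> real"
  assumes Sig_pos: "h \<in> {0..1} \<Longrightarrow> Sig h > 0"
    and G_deriv: "h \<in> {0..1} \<Longrightarrow> (G has_real_derivative G' h) (at h within {0..1})"
    and G'_deriv: "h \<in> {0..1} \<Longrightarrow> (G' has_real_derivative - 2 * Sig h) (at h within {0..1})"
    and G_0: "G 0 = 0" and G_1: "G 1 = 0"
begin

definition P :: "real \<Rightarrow> real \<Rightarrow> real" where
  "P lam h = lam * G h - h * (1 - h)"

lemma P_0 [simp]: "P lam 0 = 0" and P_1 [simp]: "P lam 1 = 0"
  by (simp_all add: P_def G_0 G_1)

lemma G_at: "0 < h \<Longrightarrow> h < 1 \<Longrightarrow> (G has_real_derivative G' h) (at h)"
  using G_deriv[of h] by (simp add: at_within_Icc_at)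

lemma G'_at: "0 < h \<Longrightarrow> h < 1 \<Longrightarrow> (G' has_real_derivative - 2 * Sig h) (at h)"
  using G'_deriv[of h] by (simp add: at_within_Icc_at)

lemma continuous_on_G: "continuous_on {0..1} G"
  using G_deriv by (rule DERIV_continuous_on)

lemma continuous_on_G': "continuous_on {0..1} G'"
  using G'_deriv by (rule DERIV_continuous_on)

lemma G'_strict_decreasing:
  assumes "0 \<le> a" "a < b" "b \<le> 1"
  shows "G' b < G' a"
proof (rule DERIV_neg_imp_decreasing_open[OF assms(2)])
  show "\<exists>y. (G' has_real_derivative y) (at x) \<and> y < 0" if "a < x" "x < b" for x
    using G'_at[of x] Sig_pos[of x] that assms by (intro exI[of _ "- 2 * Sig x"]) auto
  show "continuous_on {a..b} G'"
    using continuous_on_G' by (rule continuous_on_subset) (use assms in auto)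
qed

lemma G_mvt:
  assumes "0 \<le> a" "a < b" "b \<le> 1"
  obtains z where "a < z" "z < b" "G b - G a = (b - a) * G' z"
proof -
  have "continuous_on {a..b} G"
    using continuous_on_G by (rule continuous_on_subset) (use assms in auto)
  moreover have "G differentiable (at x)" if "a < x" "x < b" for x
    using G_at[of x] that assms real_differentiable_def by auto
  ultimately obtain l z where z: "a < z" "z < b" "DERIV G z :> l" "G b - G a = (b - a) * l"
    using MVT[OF assms(2)] by blast
  moreover have "l = G' z"
    using DERIV_unique[OF z(3) G_at] z(1,2) assms by simp
  ultimately show ?thesis
    using that by blast
qed

text \<open>Three-point form of strict concavity: by the mean value theorem both chord slopes are
  values of \<open>G'\<close>, the right-hand one taken further to the right. It is cross-multiplied
  to avoid division.\<close>

lemma G_chord: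
  assumes "0 \<le> a" "a < b" "b < c" "c \<le> 1"
  shows "(G c - G b) * (b - a) < (G b - G a) * (c - b)"
proof -
  obtain y where y: "a < y" "y < b" "G b - G a = (b - a) * G' y"
    by (rule G_mvt[of a b]) (use assms in auto)
  obtain z where z: "b < z" "z < c" "G c - G b = (c - b) * G' z"
    by (rule G_mvt[of b c]) (use assms in auto)
  have "G' z < G' y"
    using G'_strict_decreasing[of y z] y z assms by auto
  then have "(b - a) * (c - b) * G' z < (b - a) * (c - b) * G' y"
    using assms by simp
  then show ?thesis
    by (simp add: y(3) z(3) mult_ac)
qed

lemma G_pos:
  assumes "0 < h" "h < 1"
  shows "G h > 0"
  using G_chord[of 0 h 1] assms by (simp add: G_0 G_1 algebra_simps)

lemma G_nonneg: "h \<in> {0..1} \<Longrightarrow> G h \<ge> 0"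
  using G_pos[of h] G_0 G_1 by (cases "h = 0"; cases "h = 1") (auto simp: less_imp_le)

text \<open>Concavity puts \<open>G\<close> below its tangent at \<open>0\<close>. Together with
  \<open>G_tangent_1\<close> this serves the end-slope estimates for the coupled problem.\<close>

lemma G_tangent_0: "h \<in> {0..1} \<Longrightarrow> G h \<le> G' 0 * h"
proof (cases "h = 0")
  case False
  assume h: "h \<in> {0..1}"
  obtain z where z: "0 < z" "z < h" "G h - G 0 = (h - 0) * G' z"
    by (rule G_mvt[of 0 h]) (use h False in auto)
  have "h * G' z \<le> h * G' 0"
    using G'_strict_decreasing[of 0 z] z h by (intro mult_left_mono) auto
  then show ?thesis
    using z(3) by (simp add: G_0 mult.commute)
qed (simp add: G_0)

lemma G_tangent_1: "h \<in> {0..1} \<Longrightarrow> G h \<le> - G' 1 * (1 - h)"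
proof (cases "h = 1")
  case False
  assume h: "h \<in> {0..1}"
  obtain z where z: "h < z" "z < 1" "G 1 - G h = (1 - h) * G' z"
    by (rule G_mvt[of h 1]) (use h False in auto)
  have "(1 - h) * G' 1 \<le> (1 - h) * G' z"
    using G'_strict_decreasing[of z 1] z h by (intro mult_left_mono) auto
  then show ?thesis
    using z(3) by (simp add: G_1 algebra_simps)
qed (simp add: G_1)

section \<open>Scaling in \<open>lam\<close> and existence of a discrete solution\<close>

lemma P_scale:
  assumes "0 < lam" "lam \<le> mu" "h \<in> {0..1}"
  shows "P lam h \<le> lam / mu * P mu h"
proof -
  \<comment> \<open>The factor \<open>lam / mu\<close> turns \<open>mu * G h\<close> into
    \<open>lam * G h\<close> exactly, but keeps only a fraction of the subtracted term
    \<open>h * (1 - h)\<close>.\<close>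
  have "lam / mu * (h * (1 - h)) \<le> h * (1 - h)"
    using assms by (intro mult_left_le_one_le) auto
  moreover have "lam / mu * (mu * G h) = lam * G h"
    using assms by simp
  ultimately show ?thesis
    by (simp add: P_def right_diff_distrib)
qed

lemma quad_P_scale:
  assumes "admissible (P lam) x N" "admissible (P mu) x N" "0 < lam" "lam \<le> mu"
    and "\<And>j. j \<le> N \<Longrightarrow> x j \<in> {0..1}" "\<And>j. j < N \<Longrightarrow> x j < x (Suc j)"
  shows "quad (P mu) x N \<le> sqrt (lam / mu) * quad (P lam) x N"
  using assms by (intro quad_scale P_scale) (auto simp: less_imp_le)

text \<open>Concavity of \<open>G\<close> compares \<open>G h\<close> with the chords from \<open>(k, G k)\<close> to the two end points.\<close>
lemma P_le_of_chord:
  assumes k: "0 < k" "k < 1" "s > 0" "s * G k = c * (k * (1 - k))" "c \<ge> 1"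
    and h: "h \<in> {0..1}"
  shows "h \<le> k \<Longrightarrow> P s h \<le> c * k" and "k \<le> h \<Longrightarrow> P s h \<le> c * (1 - k)"
proof -
  have hh: "0 \<le> h * (1 - h)"
    using h by auto
  { assume "h \<le> k"
    have "G h * (1 - k) \<le> G k * (1 - h)"
      using G_chord[of h k 1] \<open>h \<le> k\<close> k h by (cases "h = k") (auto simp: G_1 algebra_simps)
    then have "s * G h * (1 - k) \<le> s * G k * (1 - h)"
      using k(3) by (simp add: mult.assoc)
    also have "\<dots> \<le> s * G k * 1"
      using h k G_nonneg[of k] by (intro mult_left_mono) auto
    finally have "s * G h * (1 - k) \<le> (c * k) * (1 - k)"
      by (simp add: k(4))
    then show "P s h \<le> c * k"
      using k(2) hh by (simp add: P_def)
  }
  { assume "k \<le> h"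
    have "G h * k \<le> G k * h"
      using G_chord[of 0 k h] \<open>k \<le> h\<close> k h by (cases "h = k") (auto simp: G_0 algebra_simps)
    then have "s * G h * k \<le> s * G k * h"
      using k(3) by (simp add: mult.assoc)
    also have "\<dots> \<le> s * G k * 1"
      using h k G_nonneg[of k] by (intro mult_left_mono) auto
    finally have "s * G h * k \<le> (c * (1 - k)) * k"
      by (simp add: k(4) mult_ac)
    then show "P s h \<le> c * (1 - k)"
      using k(1) hh by (simp add: P_def)
  }
qed

text \<open>Only the order of the nodes and their end values enter, so existence holds on any mesh;
  the sine-squared form matters for the limit alone.\<close>

lemma quad_existence:
  assumes N: "N \<ge> 2" and x0: "x 0 = 0" and xN: "x N = 1"
    and inc: "\<And>i j. i < j \<Longrightarrow> j \<le> N \<Longrightarrow> x i < x j"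
  shows "\<exists>lam>0. admissible (P lam) x N \<and> quad (P lam) x N = 1"
proof -
  have x01: "x j \<in> {0..1}" if "j \<le> N" for j
    using inc[of 0 j] inc[of j N] that x0 xN by (cases "j = 0"; cases "j = N") auto
  have xint: "0 < x j" "x j < 1" if "0 < j" "j < N" for j
    using inc[of 0 j] inc[of j N] that x0 xN by auto
  define I where "I = {0<..<N}"
  \<comment> \<open>\<open>Q j\<close> is the \<open>lam\<close> at which \<open>P lam (x j)\<close>
    vanishes, so \<open>P lam\<close> is positive at all interior nodes exactly when
    \<open>lam\<close> exceeds the maximum of \<open>Q\<close>, attained at
    \<open>m\<close>.\<close>
  define Q where "Q j = x j * (1 - x j) / G (x j)" for j
  have I: "finite I" "1 \<in> I"
    using N by (auto simp: I_def)
  obtain m where m: "m \<in> I" "Q m = Max (Q ` I)"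
    using Max_in[of "Q ` I"] I by (metis empty_iff finite_imageI image_iff image_is_empty)
  have Qle: "Q j \<le> Q m" if "j \<in> I" for j
    using I that m by simp
  define k where "k = x m"
  have k: "0 < k" "k < 1" and mN: "0 < m" "m < N"
    using xint[of m] m by (auto simp: k_def I_def)
  have Qpos: "Q m > 0"
    using k G_pos[of k] by (simp add: Q_def k_def)
  \<comment> \<open>Tuned to make the lower bound below exactly \<open>1\<close>: the cells left of
    \<open>k\<close> contribute at least \<open>sqrt k / c\<close>, those right of it at least
    \<open>sqrt (1 - k) / c\<close>.\<close>
  define c where "c = sqrt k + sqrt (1 - k)"
  have c1: "c > 1"
  proof (rule power2_less_imp_less)
    show "1\<^sup>2 < c\<^sup>2"
      using k by (simp add: c_def power2_sum)
  qed (use k in \<open>simp add: c_def\<close>)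
  have adm: "admissible (P s) x N" if "s > Q m" for s
  proof (rule admissible_of_interior[OF N])
    fix j assume j: "0 < j" "j < N"
    have "Q j < s"
      using Qle[of j] j that by (simp add: I_def)
    then show "P s (x j) > 0"
      using G_pos[of "x j"] xint[OF j] by (simp add: P_def Q_def field_simps)
  qed (simp_all add: x0 xN)
  \<comment> \<open>The factor \<open>c\<^sup>2\<close> gives
    \<open>a * G k = c\<^sup>2 * (k * (1 - k))\<close>, so the chord bounds read
    \<open>c\<^sup>2 * k\<close> left of \<open>k\<close> and \<open>c\<^sup>2 * (1 - k)\<close>
    right of it.\<close>
  define a where "a = Q m * c\<^sup>2"
  have a: "a > Q m"
    using Qpos c1 by (simp add: a_def power2_eq_square) (meson less_1_mult)
  have aG: "a * G k = c\<^sup>2 * (k * (1 - k))"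
    using G_pos[OF k] by (simp add: a_def Q_def k_def)
  have "quad (P a) x N \<ge> 1"
  proof -
    define t where "t j = (x (Suc j) - x j) / ((1/2) * (sqrt (P a (x j)) + sqrt (P a (x (Suc j)))))" for j
    \<comment> \<open>A bound common to both ends of a cell replaces the denominator by the constant
      \<open>c * sqrt y\<close>; the sums on either side of \<open>k\<close> then telescope.\<close>
    have term_ge: "(x (Suc j) - x j) / (c * sqrt y) \<le> t j"
      if j: "j < N" and "y > 0" "P a (x j) \<le> c\<^sup>2 * y" "P a (x (Suc j)) \<le> c\<^sup>2 * y" for j y
    proof -
      have "sqrt (P a (x j)) \<le> c * sqrt y" "sqrt (P a (x (Suc j))) \<le> c * sqrt y"
        using that c1 by (auto intro!: real_le_lsqrt simp: power_mult_distrib intro: order_trans)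
      then show ?thesis
        unfolding t_def using admissibleD[OF adm[OF a] j] inc[of j "Suc j"] j
        by (intro divide_left_mono) auto
    qed
    have "(\<Sum>j<m. t j) \<ge> (\<Sum>j<m. (x (Suc j) - x j) / (c * sqrt k))"
    proof (intro sum_mono term_ge)
      fix j assume "j \<in> {..<m}"
      then have j: "j < m" by simp
      have "x j \<le> k" "x (Suc j) \<le> k"
        using j mN inc[of j m] inc[of "Suc j" m] by (cases "Suc j = m"; auto simp: k_def)+
      then show "P a (x j) \<le> c\<^sup>2 * k" "P a (x (Suc j)) \<le> c\<^sup>2 * k"
        using P_le_of_chord(1)[OF k _ aG] a Qpos c1 x01[of j] x01[of "Suc j"] j mN by auto
    qed (use mN k in auto)
    moreover have "(\<Sum>j=m..<N. t j) \<ge> (\<Sum>j=m..<N. (x (Suc j) - x j) / (c * sqrt (1 - k)))"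
    proof (intro sum_mono term_ge)
      fix j assume "j \<in> {m..<N}"
      then have j: "m \<le> j" "j < N" by auto
      have "k \<le> x j" "k \<le> x (Suc j)"
        using j mN inc[of m j] inc[of m "Suc j"] by (cases "m = j"; auto simp: k_def)+
      then show "P a (x j) \<le> c\<^sup>2 * (1 - k)" "P a (x (Suc j)) \<le> c\<^sup>2 * (1 - k)"
        using P_le_of_chord(2)[OF k _ aG] a Qpos c1 x01[of j] x01[of "Suc j"] j mN by auto
    qed (use mN k in auto)
    moreover have "(\<Sum>j<m. (x (Suc j) - x j) / (c * sqrt k)) = sqrt k / c"
      using sum_lessThan_telescope[of x m] k c1
      by (simp add: x0 flip: sum_divide_distrib k_def) (simp add: field_simps)
    moreover have "(\<Sum>j=m..<N. (x (Suc j) - x j) / (c * sqrt (1 - k))) = sqrt (1 - k) / c"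
      using sum_Suc_diff'[of m N x] k c1 mN
      by (simp add: xN flip: sum_divide_distrib k_def) (simp add: field_simps)
    moreover have "quad (P a) x N = (\<Sum>j<m. t j) + (\<Sum>j=m..<N. t j)"
      unfolding quad_def t_def
      using mN by (subst sum.union_disjoint [symmetric]) (auto intro!: sum.cong)
    moreover have "sqrt k / c + sqrt (1 - k) / c = 1"
      using c1 by (simp add: c_def flip: add_divide_distrib)
    ultimately show ?thesis
      by linarith
  qed
  define q where "q = quad (P a) x N"
  \<comment> \<open>Passing from \<open>a\<close> to \<open>b\<close> multiplies the sum by at most
    \<open>sqrt (a / b) = 1 / q\<close>, which brings its value \<open>q\<close> down to at most
    \<open>1\<close>.\<close>
  define b where "b = a * q\<^sup>2"
  have q: "q \<ge> 1"
    using \<open>quad (P a) x N \<ge> 1\<close> by (simp add: q_def)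
  have b: "a \<le> b"
    using q a Qpos by (simp add: b_def)
  have "quad (P b) x N \<le> sqrt (a / b) * q"
    unfolding q_def using a b Qpos inc x01 by (intro quad_P_scale adm) auto
  also have "\<dots> = 1"
    using q a Qpos by (simp add: b_def real_sqrt_divide)
  finally have "quad (P b) x N \<le> 1" .
  \<comment> \<open>Every \<open>s\<close> in this interval exceeds \<open>Q m\<close>, so no
    denominator vanishes.\<close>
  moreover have "continuous_on {a..b} (\<lambda>s. quad (P s) x N)"
    unfolding quad_def P_def
  proof (intro continuous_intros)
    fix j assume "j \<in> {..<N}"
    then have "1 / 2 * (sqrt (P s (x j)) + sqrt (P s (x (Suc j)))) \<noteq> 0" if "s \<in> {a..b}" for s
      using admissibleD[OF adm, of s j] a that by simp
    then show "\<forall>s\<in>{a..b}. 1 / 2 * (sqrt (s * G (x j) - x j * (1 - x j)) +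
        sqrt (s * G (x (Suc j)) - x (Suc j) * (1 - x (Suc j)))) \<noteq> 0"
      unfolding P_def by blast
  qed
  ultimately obtain s where "a \<le> s" "s \<le> b" "quad (P s) x N = 1"
    using IVT2'[of "\<lambda>s. quad (P s) x N" b 1 a] b q by (auto simp: q_def)
  then show ?thesis
    using adm[of s] a Qpos by (intro exI[of _ s]) auto
qed

text \<open>With \<open>P'_deriv\<close> this shows that \<open>P lam\<close> solves the boundary
  value problem of \<open>\<psi> lam\<close>, which later identifies the two.\<close>

lemma P_deriv:
  assumes "h \<in> {0..1}"
  shows "(P lam has_real_derivative lam * G' h - (1 - 2 * h)) (at h within {0..1})"
  unfolding P_def[abs_def] using G_deriv[OF assms]
  by (auto intro!: derivative_eq_intros simp: algebra_simps)

lemma P'_deriv: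
  assumes "h \<in> {0..1}"
  shows "((\<lambda>h. lam * G' h - (1 - 2 * h)) has_real_derivative 2 - 2 * lam * Sig h) (at h within {0..1})"
  using G'_deriv[OF assms] by (auto intro!: derivative_eq_intros simp: algebra_simps)

lemma P_at:
  assumes "0 < h" "h < 1"
  shows "(P lam has_real_derivative lam * G' h - (1 - 2 * h)) (at h)"
  using P_deriv[of h lam] assms by (simp add: at_within_Icc_at)

lemma continuous_on_P: "continuous_on {0..1} (P lam)"
  using P_deriv by (rule DERIV_continuous_on)

end

section \<open>Limit of the discrete sums and the travel-time integral\<close>

lemma continuous_on_ratio:
  fixes f :: "real \<Rightarrow> real"
  assumes cont: "continuous_on {0..1} f" and f01: "f 0 = 0" "f 1 = 0"
    and d0: "(f has_real_derivative d0) (at 0 within {0..1})"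
    and d1: "(f has_real_derivative d1) (at 1 within {0..1})"
  shows "continuous_on {0..1} (\<lambda>h. if h = 0 then d0 else if h = 1 then - d1 else f h / (h * (1 - h)))"
    (is "continuous_on _ ?p")
  unfolding continuous_on_def
proof
  fix x :: real assume x: "x \<in> {0..1}"
  consider "x = 0" | "x = 1" | "0 < x" "x < 1"
    using x by fastforce
  then show "(?p \<longlongrightarrow> ?p x) (at x within {0..1})"
  proof cases
    case 1
    \<comment> \<open>At \<open>0\<close> the ratio is the difference quotient of \<open>f\<close>
      divided by \<open>1 - y\<close>; at \<open>1\<close> it is minus the difference quotient
      divided by \<open>y\<close>. Hence the end values \<open>d0\<close> and
      \<open>- d1\<close>.\<close>
    have "((\<lambda>y. (f y - f 0) / (y - 0) / (1 - y)) \<longlongrightarrow> d0 / (1 - 0)) (at 0 within {0..1})"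
      using d0 by (intro tendsto_intros) (auto simp: has_field_derivative_iff)
    moreover have "\<forall>\<^sub>F y in at 0 within {0..1}. (f y - f 0) / (y - 0) / (1 - y) = ?p y"
      unfolding eventually_at by (intro exI[of _ 1]) (auto simp: f01 dist_real_def)
    ultimately show ?thesis
      using 1 by (auto dest: Lim_transform_eventually)
  next
    case 2
    have "((\<lambda>y. - ((f y - f 1) / (y - 1)) / y) \<longlongrightarrow> - d1 / 1) (at 1 within {0..1})"
      using d1 by (intro tendsto_intros) (auto simp: has_field_derivative_iff)
    moreover have "\<forall>\<^sub>F y in at 1 within {0..1}. - ((f y - f 1) / (y - 1)) / y = ?p y"
      unfolding eventually_at
      by (intro exI[of _ 1], auto simp: f01 dist_real_def divide_simps, simp add: algebra_simps)
    ultimately show ?thesis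
      using 2 by (auto dest: Lim_transform_eventually)
  next
    case 3
    have "(f \<longlongrightarrow> f x) (at x within {0..1})"
      using cont x by (simp add: continuous_on_def)
    then have "((\<lambda>y. f y / (y * (1 - y))) \<longlongrightarrow> f x / (x * (1 - x))) (at x within {0..1})"
      using 3 by (intro tendsto_intros) auto
    moreover have "\<forall>\<^sub>F y in at x within {0..1}. f y / (y * (1 - y)) = ?p y"
      unfolding eventually_at
      using 3 by (intro exI[of _ "min x (1 - x)"]) (auto simp: dist_real_def)
    ultimately show ?thesis
      using 3 by (auto dest: Lim_transform_eventually)
  qed
qed

text \<open>The weighted mean \<open>m\<close> lies between the two end values, so the intermediate
  value theorem attains it; the cases differ only in which end value is larger.\<close>

lemma weighted_mean_value:
  fixes f :: "real \<Rightarrow> real"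
  assumes "continuous_on {a..b} f" "a \<le> b" "u \<ge> 0" "v \<ge> 0" "u + v > 0"
  obtains x where "x \<in> {a..b}" "u * f a + v * f b = (u + v) * f x"
proof -
  define m where "m = (u * f a + v * f b) / (u + v)"
  have lo: "c \<le> m" if "c \<le> f a" "c \<le> f b" for c
    using mult_left_mono[OF that(1) assms(3)] mult_left_mono[OF that(2) assms(4)] assms(5)
    by (simp add: m_def field_simps)
  have hi: "m \<le> c" if "f a \<le> c" "f b \<le> c" for c
    using mult_left_mono[OF that(1) assms(3)] mult_left_mono[OF that(2) assms(4)] assms(5)
    by (simp add: m_def field_simps)
  have "\<exists>x. a \<le> x \<and> x \<le> b \<and> f x = m"
  proof (cases "f a \<le> f b")
    case True
    then show ?thesis
      by (intro IVT' lo hi assms) auto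
  next
    case False
    then show ?thesis
      by (intro IVT2' lo hi assms) auto
  qed
  then obtain x where x: "x \<in> {a..b}" "f x = m"
    by auto
  moreover have "u * f a + v * f b = (u + v) * f x"
    using assms(5) x by (simp add: m_def)
  ultimately show ?thesis
    using that by blast
qed

text \<open>This and \<open>sin_cos_sum\<close> share the factor \<open>sin (a + b)\<close>, which
  cancels between numerator and denominator of a summand and leaves
  \<open>tan (b - a)\<close>.\<close>

lemma sin_squared_diff: "(sin b)\<^sup>2 - (sin a)\<^sup>2 = sin (a + b) * sin (b - a)" for a b :: real
proof -
  have "sin (a + b) * sin (b - a) = (sin b)\<^sup>2 * (cos a)\<^sup>2 - (cos b)\<^sup>2 * (sin a)\<^sup>2"
    by (simp add: sin_add sin_diff power2_eq_square algebra_simps)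
  then show ?thesis
    by (simp add: cos_squared_eq algebra_simps)
qed

lemma sin_cos_sum: "sin a * cos a + sin b * cos b = sin (a + b) * cos (b - a)" for a b :: real
proof -
  have "sin (a + b) * cos (b - a) =
      sin a * cos a * ((sin b)\<^sup>2 + (cos b)\<^sup>2) + sin b * cos b * ((sin a)\<^sup>2 + (cos a)\<^sup>2)"
    unfolding sin_add cos_diff by algebra
  then show ?thesis
    by simp
qed

text \<open>At \<open>sin\<^sup>2 t\<close> the root of \<open>f\<close> is
  \<open>sin t * cos t * q\<close>, so the denominator is a weighted sum of two values of
  \<open>q\<close>, which the weighted mean value replaces by a single one.\<close>

lemma quad_sin_squared_term:
  assumes q: "continuous_on {0..1} q" "\<And>h. h \<in> {0..1} \<Longrightarrow> q h > 0"
    and f: "\<And>h. h \<in> {0..1} \<Longrightarrow> f h = h * (1 - h) * (q h)\<^sup>2"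
    and ab: "0 \<le> a" "a < b" "b \<le> pi / 2" "b - a < pi / 2"
  obtains t where "t \<in> {a..b}"
    "((sin b)\<^sup>2 - (sin a)\<^sup>2) / ((1/2) * (sqrt (f ((sin a)\<^sup>2)) + sqrt (f ((sin b)\<^sup>2))))
      = tan (b - a) * (2 / q ((sin t)\<^sup>2))"
proof -
  have sin01: "(sin t)\<^sup>2 \<in> {0..1}" for t :: real
    by (simp add: abs_square_le_1)
  have sqrt_f: "sqrt (f ((sin t)\<^sup>2)) = sin t * cos t * q ((sin t)\<^sup>2)" if "t \<in> {0..pi/2}" for t
  proof -
    have "f ((sin t)\<^sup>2) = (sin t * cos t * q ((sin t)\<^sup>2))\<^sup>2"
      by (simp add: f[OF sin01] power_mult_distrib cos_squared_eq)
    moreover have "sin t * cos t * q ((sin t)\<^sup>2) \<ge> 0"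
      using that q(2)[OF sin01, of t] by (intro mult_nonneg_nonneg sin_ge_zero cos_ge_zero) auto
    ultimately show ?thesis
      by simp
  qed
  have pos: "sin (a + b) > 0" "cos (b - a) > 0"
    using ab by (auto intro!: sin_gt_zero cos_gt_zero)
  have "continuous_on {a..b} (\<lambda>t. q ((sin t)\<^sup>2))"
    by (rule continuous_on_compose2[OF q(1)]) (use sin01 in \<open>auto intro!: continuous_intros\<close>)
  moreover have "sin a * cos a \<ge> 0" "sin b * cos b \<ge> 0"
    using ab by (auto intro!: mult_nonneg_nonneg sin_ge_zero cos_ge_zero)
  moreover have sum_pos: "sin a * cos a + sin b * cos b > 0"
    using pos by (simp add: sin_cos_sum)
  ultimately obtain t where t: "t \<in> {a..b}"
    "sin a * cos a * q ((sin a)\<^sup>2) + sin b * cos b * q ((sin b)\<^sup>2)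
      = (sin a * cos a + sin b * cos b) * q ((sin t)\<^sup>2)"
    using ab(2) by (elim weighted_mean_value) (auto simp: less_imp_le)
  have "((sin b)\<^sup>2 - (sin a)\<^sup>2) / ((1/2) * (sqrt (f ((sin a)\<^sup>2)) + sqrt (f ((sin b)\<^sup>2))))
      = (sin (a + b) * sin (b - a)) / ((1/2) * (sin (a + b) * cos (b - a) * q ((sin t)\<^sup>2)))"
    using ab by (simp add: sqrt_f t(2) sin_squared_diff sin_cos_sum)
  also have "\<dots> = tan (b - a) * (2 / q ((sin t)\<^sup>2))"
    using pos q(2)[OF sin01, of t] by (simp add: tan_def field_simps)
  finally show ?thesis
    using that t(1) by blast
qed

lemma quad_node_limit:
  assumes q: "continuous_on {0..1} q" "\<And>h. h \<in> {0..1} \<Longrightarrow> q h > 0"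
    and f: "\<And>h. h \<in> {0..1} \<Longrightarrow> f h = h * (1 - h) * (q h)\<^sup>2"
  shows "(\<lambda>N. quad f (node N) N) \<longlonglongrightarrow> integral {0..pi/2} (\<lambda>t. 2 / q ((sin t)\<^sup>2))"
proof -
  have sin01: "(sin t)\<^sup>2 \<in> {0..1}" for t :: real
    by (simp add: abs_square_le_1)
  define F where "F t = 2 / q ((sin t)\<^sup>2)" for t
  define J where "J t = integral {0..t} F" for t
  \<comment> \<open>The nodes are equally spaced in the angle, with step \<open>d N\<close>.\<close>
  define d where "d N = pi / (2 * real N)" for N :: nat
  have contF: "continuous_on {0..pi/2} F"
    unfolding F_def
    by (intro continuous_intros continuous_on_compose2[OF q(1)])
       (use sin01 in \<open>auto intro!: continuous_intros simp: less_imp_neq[OF q(2), symmetric]\<close>)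
  have J_deriv: "(J has_real_derivative F t) (at t within {0..pi/2})" if "t \<in> {0..pi/2}" for t
    unfolding J_def using integral_has_real_derivative[OF contF that] .
  have J_cont: "continuous_on {0..pi/2} J"
    using J_deriv by (rule DERIV_continuous_on)
  \<comment> \<open>The factor \<open>d N / tan (d N)\<close> turns each summand into
    \<open>d N * F t\<close>. The matching increment of \<open>J\<close> is \<open>d N * F s\<close>
    with \<open>s\<close> and \<open>t\<close> in the same cell, so the oscillation of
    \<open>F\<close> on a cell controls the error.\<close>
  have approx: "\<bar>quad f (node N) N * (d N / tan (d N)) - J (pi/2)\<bar> \<le> e * (pi/2)"
    if N: "N \<ge> 2" and e: "e > 0"
      and unif: "\<And>s t. s \<in> {0..pi/2} \<Longrightarrow> t \<in> {0..pi/2} \<Longrightarrow> \<bar>s - t\<bar> \<le> d N \<Longrightarrow> \<bar>F s - F t\<bar> \<le> e"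
    for N e
  proof -
    define th where "th j = real j * d N" for j
    have dN: "0 < d N" "d N < pi / 2"
      using N by (auto simp: d_def field_simps)
    have th: "0 \<le> th j" "th j < th (Suc j)" "th (Suc j) - th j = d N" for j
      using dN by (auto simp: th_def algebra_simps)
    have thN: "th N = pi / 2"
      using N by (simp add: th_def d_def)
    have th_le: "th (Suc j) \<le> pi / 2" if "j < N" for j
      unfolding thN[symmetric] th_def using that dN by (intro mult_right_mono) auto
    have tan_pos: "tan (d N) > 0"
      using dN by (intro tan_gt_zero)
    have node: "node N j = (sin (th j))\<^sup>2" for j
      by (simp add: node_def th_def d_def mult_ac)
    define u where "u j = (node N (Suc j) - node N j) /
        ((1/2) * (sqrt (f (node N j)) + sqrt (f (node N (Suc j)))))" for j
    have "\<bar>u j * (d N / tan (d N)) - (J (th (Suc j)) - J (th j))\<bar> \<le> e * d N" if j: "j < N" for j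
    proof -
      have "th (Suc j) - th j < pi / 2"
        using th(3) dN by simp
      from quad_sin_squared_term[OF q f th(1) th(2) th_le[OF j] this]
      obtain t where t: "t \<in> {th j..th (Suc j)}" "u j = tan (d N) * F t"
        unfolding u_def node F_def th(3) by blast
      have sub: "{th j..th (Suc j)} \<subseteq> {0..pi/2}"
        using th(1)[of j] th_le[OF j] by auto
      have "(J has_real_derivative F x) (at x)" if "th j < x" "x < th (Suc j)" for x
        using J_deriv[of x] that th(1)[of j] th_le[OF j] by (simp add: at_within_Icc_at)
      then obtain s where s: "th j < s" "s < th (Suc j)"
          "J (th (Suc j)) - J (th j) = (th (Suc j) - th j) * F s"
        using MVT[OF th(2)[of j] continuous_on_subset[OF J_cont sub]]
        by (metis DERIV_unique real_differentiable_def)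
      have "\<bar>F t - F s\<bar> \<le> e"
        using t(1) s sub th(3)[of j] by (intro unif) (auto simp: abs_le_iff)
      then have "d N * \<bar>F t - F s\<bar> \<le> e * d N"
        using dN by (simp add: mult.commute)
      moreover have "u j * (d N / tan (d N)) - (J (th (Suc j)) - J (th j)) = d N * (F t - F s)"
        using tan_pos s(3) th(3)[of j] by (simp add: t(2) algebra_simps)
      ultimately show ?thesis
        using dN by (simp add: abs_mult)
    qed
    then have "\<bar>\<Sum>j<N. u j * (d N / tan (d N)) - (J (th (Suc j)) - J (th j))\<bar> \<le> (\<Sum>j<N. e * d N)"
      by (intro order_trans[OF sum_abs] sum_mono) auto
    also have "(\<Sum>j<N. e * d N) = e * (pi/2)"
      using N by (simp add: d_def)
    also have "(\<Sum>j<N. u j * (d N / tan (d N)) - (J (th (Suc j)) - J (th j)))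
        = quad f (node N) N * (d N / tan (d N)) - (J (th N) - J (th 0))"
      unfolding sum_subtractf[of "\<lambda>j. u j * (d N / tan (d N))"] sum_lessThan_telescope[of "\<lambda>j. J (th j)"]
      by (simp only: quad_def u_def sum_distrib_right)
    finally show ?thesis
      by (simp only: thN) (simp add: J_def th_def)
  qed
  have d_lim: "d \<longlonglongrightarrow> 0"
    using tendsto_mult[OF tendsto_const[of "pi/2"] lim_inverse_n] by (simp add: d_def[abs_def] field_simps)
  have "(\<lambda>N. quad f (node N) N * (d N / tan (d N))) \<longlonglongrightarrow> J (pi/2)"
  proof (rule tendstoI)
    fix e :: real assume e: "e > 0"
    have "uniformly_continuous_on {0..pi/2} F"
      using contF by (intro compact_uniformly_continuous) auto
    then obtain r where r: "r > 0"
      "\<And>s t. s \<in> {0..pi/2} \<Longrightarrow> t \<in> {0..pi/2} \<Longrightarrow> dist s t < r \<Longrightarrow> dist (F s) (F t) < e / pi"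
      using e unfolding uniformly_continuous_on_def by (metis divide_pos_pos pi_gt_zero)
    have "\<forall>\<^sub>F N in sequentially. d N < r"
      using d_lim r(1) by (rule order_tendstoD)
    then show "\<forall>\<^sub>F N in sequentially. dist (quad f (node N) N * (d N / tan (d N))) (J (pi/2)) < e"
      using eventually_ge_at_top[of 2]
    proof eventually_elim
      case (elim N)
      have "\<bar>quad f (node N) N * (d N / tan (d N)) - J (pi/2)\<bar> \<le> e / pi * (pi/2)"
        using e r(2) elim by (intro approx) (auto simp: dist_real_def intro!: less_imp_le)
      also have "\<dots> < e"
        using e by simp
      finally show ?case
        by (simp add: dist_real_def)
    qed
  qed
  \<comment> \<open>This limit, the derivative of \<open>tan\<close> at \<open>0\<close>, removes
    the correction factor again.\<close>
  moreover have "(\<lambda>N. tan (d N) / d N) \<longlonglongrightarrow> 1"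
  proof -
    have "\<forall>\<^sub>F N in sequentially. d N \<noteq> 0"
      using eventually_gt_at_top[of 0] by eventually_elim (simp add: d_def)
    then have "filterlim d (at 0) sequentially"
      using d_lim by (simp add: filterlim_at)
    moreover have "((\<lambda>y. tan y / y) \<longlongrightarrow> 1) (at (0::real))"
      using DERIV_tan[of 0] by (simp add: has_field_derivative_iff)
    ultimately show ?thesis
      by (rule filterlim_compose[rotated])
  qed
  ultimately have "(\<lambda>N. quad f (node N) N * (d N / tan (d N)) * (tan (d N) / d N)) \<longlonglongrightarrow> J (pi/2) * 1"
    by (intro tendsto_mult)
  \<comment> \<open>The factors cancel only from \<open>N = 2\<close> on: for \<open>N = 0\<close>
    and \<open>N = 1\<close> the HOL value of \<open>tan (d N)\<close> is \<open>0\<close>.\<close>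
  moreover have "\<forall>\<^sub>F N in sequentially.
      quad f (node N) N * (d N / tan (d N)) * (tan (d N) / d N) = quad f (node N) N"
    using eventually_ge_at_top[of 2]
  proof eventually_elim
    case (elim N)
    have "0 < d N" "d N < pi / 2"
      using elim by (auto simp: d_def field_simps)
    then have "tan (d N) > 0"
      by (rule tan_gt_zero)
    then show ?case
      using \<open>0 < d N\<close> by simp
  qed
  ultimately have "(\<lambda>N. quad f (node N) N) \<longlonglongrightarrow> J (pi/2) * 1"
    by (rule Lim_transform_eventually)
  then show ?thesis
    by (simp add: J_def F_def[abs_def])
qed

text \<open>In the angle \<open>T\<close> with \<open>h = sin\<^sup>2 T\<close> the equation for
  \<open>h\<close> becomes \<open>T' = q(h) / 2\<close>, free of the end-point singularities. Hence
  \<open>J (T z)\<close> and \<open>z\<close> have equal derivatives, while \<open>T\<close> runs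
  from \<open>0\<close> to \<open>pi/2\<close>.\<close>

lemma travel_time_integral:
  assumes q: "continuous_on {0..1} q" "\<And>h. h \<in> {0..1} \<Longrightarrow> q h > 0"
    and h: "continuous_on {0..1} h" "h 0 = 0" "h 1 = 1"
    and h01: "\<And>z. z \<in> {0<..<1} \<Longrightarrow> h z \<in> {0<..<1}"
    and dh: "\<And>z. z \<in> {0<..<1} \<Longrightarrow> (h has_real_derivative \<phi> z) (at z)"
    and \<phi>: "\<And>z. z \<in> {0<..<1} \<Longrightarrow> \<phi> z = sqrt (h z * (1 - h z)) * q (h z)"
  shows "integral {0..pi/2} (\<lambda>t. 2 / q ((sin t)\<^sup>2)) = 1"
proof -
  have sin01: "(sin t)\<^sup>2 \<in> {0..1}" for t :: real
    by (simp add: abs_square_le_1)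
  define F where "F t = 2 / q ((sin t)\<^sup>2)" for t
  define J where "J t = integral {0..t} F" for t
  define T where "T z = arcsin (sqrt (h z))" for z
  have contF: "continuous_on {0..pi/2} F"
    unfolding F_def
    by (intro continuous_intros continuous_on_compose2[OF q(1)])
       (use sin01 in \<open>auto intro!: continuous_intros simp: less_imp_neq[OF q(2), symmetric]\<close>)
  have J_deriv: "(J has_real_derivative F t) (at t within {0..pi/2})" if "t \<in> {0..pi/2}" for t
    unfolding J_def using integral_has_real_derivative[OF contF that] .
  have h_bounds: "h z \<in> {0..1}" if "z \<in> {0..1}" for z
    using h01[of z] h(2,3) that by (cases "z = 0"; cases "z = 1") auto
  have T_range: "T z \<in> {0..pi/2}" if "z \<in> {0..1}" for z
  proof -
    have "0 \<le> sqrt (h z)" "sqrt (h z) \<le> 1"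
      using h_bounds[OF that] by auto
    moreover from this have "arcsin (sqrt (h z)) \<le> pi / 2"
      by (intro arcsin_ubound) linarith+
    ultimately show ?thesis
      unfolding T_def using arcsin_le_arcsin[of 0 "sqrt (h z)"] by simp
  qed
  have "continuous_on {0..1} T"
    unfolding T_def using h_bounds h(1) by (intro continuous_intros) (auto intro: order_trans[of _ 0])
  then have "continuous_on {0..1} (\<lambda>z. J (T z))"
    by (intro continuous_on_compose2[OF DERIV_continuous_on[OF J_deriv]]) (use T_range in auto)
  then have cont: "continuous_on {0..1} (\<lambda>z. J (T z) - z)"
    by (intro continuous_intros)
  \<comment> \<open>Differentiation stays in the open interval, where \<open>sqrt\<close> and
    \<open>arcsin\<close> are smooth; \<open>cont\<close> covers the end points.\<close>
  have "((\<lambda>z. J (T z) - z) has_real_derivative 0) (at z)" if z: "0 < z" "z < 1" for z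
  proof -
    have hz: "0 < h z" "h z < 1"
      using h01[of z] z by auto
    have s: "0 < sqrt (h z)" "sqrt (h z) < 1"
      using hz by auto
    then have s': "- 1 < sqrt (h z)"
      by linarith
    have "sin (T z) = sqrt (h z)"
      unfolding T_def using s by (intro sin_arcsin) linarith+
    then have sinT: "(sin (T z))\<^sup>2 = h z"
      using hz by simp
    have "((\<lambda>z. sqrt (h z)) has_real_derivative inverse (sqrt (h z)) / 2 * \<phi> z) (at z)"
      using DERIV_chain2[OF DERIV_real_sqrt[OF hz(1)] dh[of z]] z by simp
    then have "(T has_real_derivative
        inverse (sqrt (1 - (sqrt (h z))\<^sup>2)) * (inverse (sqrt (h z)) / 2 * \<phi> z)) (at z)"
      unfolding T_def using s s' by (intro DERIV_chain2[OF DERIV_arcsin]) auto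
    moreover have "\<phi> z = sqrt (h z) * sqrt (1 - h z) * q (h z)"
      using \<phi>[of z] z by (simp add: real_sqrt_mult)
    then have "inverse (sqrt (1 - (sqrt (h z))\<^sup>2)) * (inverse (sqrt (h z)) / 2 * \<phi> z) = q (h z) / 2"
      using hz by (simp add: divide_simps)
    ultimately have dT: "(T has_real_derivative q (h z) / 2) (at z)"
      by simp
    have "0 < T z" "T z < pi / 2"
      unfolding T_def using s s' arcsin_less_arcsin[of 0 "sqrt (h z)"] arcsin_less_arcsin[of "sqrt (h z)" 1]
      by auto
    then have "(J has_real_derivative F (T z)) (at (T z))"
      using J_deriv[of "T z"] by (simp add: at_within_Icc_at)
    from DERIV_chain2[OF this dT] have "((\<lambda>z. J (T z)) has_real_derivative 1) (at z)"
      using q(2)[of "h z"] hz by (simp add: F_def sinT)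
    then show ?thesis
      by (auto intro!: derivative_eq_intros)
  qed
  from DERIV_isconst2[OF _ cont this, of 1] have "J (T 1) - 1 = J (T 0) - 0"
    by simp
  then show ?thesis
    by (simp add: T_def h J_def F_def[abs_def])
qed

section \<open>The coupled problem: energy identity, positivity and end slopes\<close>

locale coupled = string_data +
  fixes lam :: real and h \<phi> :: "real \<Rightarrow> real"
  assumes coupled: "coupled_solution Sig lam h \<phi>"
begin

lemma h_cont: "continuous_on {0..1} h" and phi_cont: "continuous_on {0..1} \<phi>"
  and h_0: "h 0 = 0" and h_1: "h 1 = 1" and phi_0: "\<phi> 0 = 0" and phi_1: "\<phi> 1 = 0"
  and lam_nonneg: "lam \<ge> 0"
  and phi_pos: "z \<in> {0<..<1} \<Longrightarrow> \<phi> z > 0"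
  and h_deriv: "z \<in> {0<..<1} \<Longrightarrow> (h has_real_derivative \<phi> z) (at z)"
  using coupled by (auto simp: coupled_solution_def)

lemma h_strict_mono:
  assumes "0 \<le> a" "a < b" "b \<le> 1"
  shows "h a < h b"
proof (rule DERIV_pos_imp_increasing_open[OF assms(2)])
  show "\<exists>y. (h has_real_derivative y) (at x) \<and> y > 0" if "a < x" "x < b" for x
    using h_deriv[of x] phi_pos[of x] that assms by auto
  show "continuous_on {a..b} h"
    using h_cont by (rule continuous_on_subset) (use assms in auto)
qed

lemma h_interior: "z \<in> {0<..<1} \<Longrightarrow> h z \<in> {0<..<1}"
  using h_strict_mono[of 0 z] h_strict_mono[of z 1] by (simp add: h_0 h_1)

lemma h_range: "z \<in> {0..1} \<Longrightarrow> h z \<in> {0..1}"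
  using h_interior[of z] h_0 h_1 by (cases "z = 0"; cases "z = 1") auto

text \<open>Both the first integral \<open>\<phi>' - P'(h)/2\<close> and \<open>\<phi>\<^sup>2 - P(h)\<close> minus a multiple of \<open>h\<close> are
  constant; the boundary values force that multiple to vanish.\<close>
lemma energy: "z \<in> {0..1} \<Longrightarrow> (\<phi> z)\<^sup>2 = P lam (h z)"
proof -
  obtain \<phi>' \<phi>'' where ode:
    "\<And>z. z \<in> {0<..<1} \<Longrightarrow> (\<phi> has_real_derivative \<phi>' z) (at z)"
    "\<And>z. z \<in> {0<..<1} \<Longrightarrow> (\<phi>' has_real_derivative \<phi>'' z) (at z)"
    "\<And>z. z \<in> {0<..<1} \<Longrightarrow> - \<phi>'' z + \<phi> z = lam * Sig (h z) * \<phi> z"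
    using coupled unfolding coupled_solution_def by blast
  have "((\<lambda>z. \<phi>' z - (lam * G' (h z) - (1 - 2 * h z)) / 2) has_real_derivative 0) (at z)"
    if z: "z \<in> {0<..<1}" for z
  proof -
    have "((\<lambda>z. G' (h z)) has_real_derivative - 2 * Sig (h z) * \<phi> z) (at z)"
      using DERIV_chain2[OF G'_at h_deriv[OF z]] h_interior[OF z] by auto
    then have "((\<lambda>z. \<phi>' z - (lam * G' (h z) - (1 - 2 * h z)) / 2) has_real_derivative
        \<phi>'' z - (lam * (- 2 * Sig (h z) * \<phi> z) + 2 * \<phi> z) / 2) (at z)"
      using ode(2)[OF z] h_deriv[OF z] by (auto intro!: derivative_eq_intros)
    moreover have "\<phi>'' z - (lam * (- 2 * Sig (h z) * \<phi> z) + 2 * \<phi> z) / 2 = 0"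
      using ode(3)[OF z] by (simp add: field_simps)
    ultimately show ?thesis
      by (simp only:)
  qed
  then have "\<exists>c. \<forall>z\<in>{0<..<1}. \<phi>' z - (lam * G' (h z) - (1 - 2 * h z)) / 2 = c"
    by (intro has_field_derivative_zero_constant) (auto intro: has_field_derivative_at_within)
  then obtain c where "\<forall>z\<in>{0<..<1}. \<phi>' z - (lam * G' (h z) - (1 - 2 * h z)) / 2 = c" ..
  then have c: "\<phi>' z = (lam * G' (h z) - (1 - 2 * h z)) / 2 + c" if "z \<in> {0<..<1}" for z
    using that by (auto simp: diff_eq_eq)
  define E where "E z = (\<phi> z)\<^sup>2 - P lam (h z) - 2 * c * h z" for z
  have "continuous_on {0..1} E"
    unfolding E_def using h_range
    by (intro continuous_intros h_cont phi_cont continuous_on_compose2[OF continuous_on_P h_cont]) auto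
  moreover have "(E has_real_derivative 0) (at z)" if z: "0 < z" "z < 1" for z
  proof -
    have z': "z \<in> {0<..<1}"
      using z by simp
    have "((\<lambda>z. P lam (h z)) has_real_derivative (lam * G' (h z) - (1 - 2 * h z)) * \<phi> z) (at z)"
      using DERIV_chain2[OF P_at h_deriv[OF z']] h_interior[OF z'] by auto
    then have "(E has_real_derivative
        2 * \<phi> z * \<phi>' z - (lam * G' (h z) - (1 - 2 * h z)) * \<phi> z - 2 * c * \<phi> z) (at z)"
      unfolding E_def using ode(1)[OF z'] h_deriv[OF z']
      by (auto intro!: derivative_eq_intros)
    moreover have "2 * \<phi> z * \<phi>' z - (lam * G' (h z) - (1 - 2 * h z)) * \<phi> z - 2 * c * \<phi> z = 0"
      by (simp add: c[OF z'] algebra_simps add_divide_distrib diff_divide_distrib)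
    ultimately show ?thesis
      by simp
  qed
  ultimately have const: "E z = E 0" if "z \<in> {0..1}" for z
    using DERIV_isconst2[of 0 1 E z] that by auto
  have "c = 0"
    using const[of 1] by (simp add: E_def h_0 h_1 phi_0 phi_1)
  then show "(\<phi> z)\<^sup>2 = P lam (h z)" if "z \<in> {0..1}"
    using const[OF that] by (simp add: E_def h_0 phi_0)
qed

lemma h_surj:
  assumes "k \<in> {0<..<1}"
  obtains z where "z \<in> {0<..<1}" "h z = k"
proof -
  obtain z where z: "0 \<le> z" "z \<le> 1" "h z = k"
    using IVT'[of h 0 k 1] assms h_cont h_0 h_1 by auto
  then show ?thesis
    using that[of z] assms h_0 h_1 by (cases "z = 0"; cases "z = 1") auto
qed

text \<open>Every interior height is attained by \<open>h\<close>, and there \<open>P lam\<close> is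
  the square of a positive value of \<open>\<phi>\<close>.\<close>

lemma P_pos:
  assumes "k \<in> {0<..<1}"
  shows "P lam k > 0"
proof -
  obtain z where z: "z \<in> {0<..<1}" "h z = k"
    using h_surj[OF assms] .
  then show ?thesis
    using energy[of z] phi_pos[of z] by (metis greaterThanLessThan_subseteq_atLeastAtMost_iff
        less_eq_real_def order_refl subsetD zero_less_power)
qed

text \<open>For \<open>lam = 0\<close> the value at \<open>1/2\<close> would be
  \<open>- 1/4\<close>, against \<open>P_pos\<close>.\<close>

lemma lam_pos: "lam > 0"
  using lam_nonneg P_pos[of "1/2"] by (cases "lam = 0") (auto simp: P_def)

text \<open>If the end slope of \<open>P\<close> were not positive then \<open>\<phi> \<le> h\<close>, so \<open>h\<close> could not leave \<open>0\<close>
  in finite time (Gronwall); similarly at the other end.\<close>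
lemma slope_0: "lam * G' 0 - 1 > 0"
proof (rule ccontr)
  assume "\<not> ?thesis"
  then have le1: "lam * G' 0 \<le> 1"
    by simp
  have le: "\<phi> z \<le> h z" if z: "z \<in> {0..1}" for z
  proof (rule power2_le_imp_le)
    have hz: "h z \<in> {0..1}"
      using h_range[OF z] .
    have "lam * G (h z) \<le> lam * (G' 0 * h z)"
      using G_tangent_0[OF hz] lam_nonneg by (rule mult_left_mono)
    also have "\<dots> \<le> 1 * h z"
      unfolding mult.assoc[symmetric] using le1 hz by (intro mult_right_mono) auto
    finally show "(\<phi> z)\<^sup>2 \<le> (h z)\<^sup>2"
      unfolding energy[OF z] P_def by (simp add: power2_eq_square algebra_simps)
  qed (use h_range[OF z] in auto)
  have "h 0 * exp (- 0) \<ge> h (1/2) * exp (- (1/2))"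
  proof (rule DERIV_nonpos_imp_decreasing_open[of 0 "1/2" "\<lambda>z. h z * exp (- z)"])
    fix z :: real assume z: "0 < z" "z < 1/2"
    have "((\<lambda>z. h z * exp (- z)) has_real_derivative (\<phi> z - h z) * exp (- z)) (at z)"
      using h_deriv[of z] z by (auto intro!: derivative_eq_intros simp: algebra_simps)
    moreover have "(\<phi> z - h z) * exp (- z) \<le> 0"
      using le[of z] z by (simp add: mult_le_0_iff)
    ultimately show "\<exists>y. ((\<lambda>z. h z * exp (- z)) has_real_derivative y) (at z) \<and> y \<le> 0"
      by blast
  next
    have "continuous_on {0..1/2} h"
      using h_cont by (rule continuous_on_subset) auto
    then show "continuous_on {0..1/2} (\<lambda>z. h z * exp (- z))"
      by (intro continuous_intros)
  qed simp
  then show False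
    using h_interior[of "1/2"] by (simp add: h_0 mult_le_0_iff)
qed

lemma slope_1: "- (lam * G' 1 + 1) > 0"
proof (rule ccontr)
  assume "\<not> ?thesis"
  then have le1: "lam * - G' 1 \<le> 1"
    by simp
  have le: "\<phi> z \<le> 1 - h z" if z: "z \<in> {0..1}" for z
  proof (rule power2_le_imp_le)
    have hz: "h z \<in> {0..1}"
      using h_range[OF z] .
    have "lam * G (h z) \<le> lam * (- G' 1 * (1 - h z))"
      using G_tangent_1[OF hz] lam_nonneg by (rule mult_left_mono)
    also have "\<dots> \<le> 1 * (1 - h z)"
      unfolding mult.assoc[symmetric] using le1 hz by (intro mult_right_mono) auto
    finally show "(\<phi> z)\<^sup>2 \<le> (1 - h z)\<^sup>2"
      unfolding energy[OF z] P_def by (simp add: power2_eq_square algebra_simps)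
  qed (use h_range[OF z] in auto)
  have "(1 - h (1/2)) * exp (1/2) \<le> (1 - h 1) * exp 1"
  proof (rule DERIV_nonneg_imp_increasing_open[of "1/2" 1 "\<lambda>z. (1 - h z) * exp z"])
    fix z :: real assume z: "1/2 < z" "z < 1"
    have "((\<lambda>z. (1 - h z) * exp z) has_real_derivative ((1 - h z) - \<phi> z) * exp z) (at z)"
      using h_deriv[of z] z by (auto intro!: derivative_eq_intros simp: algebra_simps)
    moreover have "((1 - h z) - \<phi> z) * exp z \<ge> 0"
      using le[of z] z by simp
    ultimately show "\<exists>y. ((\<lambda>z. (1 - h z) * exp z) has_real_derivative y) (at z) \<and> y \<ge> 0"
      by blast
  next
    have "continuous_on {1/2..1} h"
      using h_cont by (rule continuous_on_subset) auto
    then show "continuous_on {1/2..1} (\<lambda>z. (1 - h z) * exp z)"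
      by (intro continuous_intros)
  qed simp
  then show False
    using h_interior[of "1/2"] by (simp add: h_1 mult_le_0_iff)
qed

lemma quad_tendsto_1: "(\<lambda>N. quad (P lam) (node N) N) \<longlonglongrightarrow> 1"
proof -
  \<comment> \<open>The continuous extension of \<open>P lam k / (k * (1 - k))\<close>; its end
    values are the slopes shown positive in \<open>slope_0\<close> and \<open>slope_1\<close>, so
    \<open>q\<close> is positive up to the ends.\<close>
  define p where "p k = (if k = 0 then lam * G' 0 - 1 else if k = 1 then - (lam * G' 1 + 1)
    else P lam k / (k * (1 - k)))" for k
  define q where "q k = sqrt (p k)" for k
  have p_pos: "p k > 0" if "k \<in> {0..1}" for k
    using slope_0 slope_1 P_pos[of k] that by (auto simp: p_def)
  have "continuous_on {0..1} p"
    unfolding p_def using P_deriv[of 0 lam] P_deriv[of 1 lam]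
    by (intro continuous_on_ratio continuous_on_P) auto
  then have q_cont: "continuous_on {0..1} q"
    unfolding q_def by (intro continuous_intros)
  have q_pos: "q k > 0" if "k \<in> {0..1}" for k
    using p_pos[OF that] by (simp add: q_def)
  have Pq: "P lam k = k * (1 - k) * (q k)\<^sup>2" if "k \<in> {0..1}" for k
    using p_pos[OF that] by (simp add: q_def) (simp add: p_def)
  have "\<phi> z = sqrt (h z * (1 - h z)) * q (h z)" if z: "z \<in> {0<..<1}" for z
  proof -
    have "\<phi> z = sqrt (P lam (h z))"
      using energy[of z] phi_pos[OF z] z by (metis atLeastAtMost_iff greaterThanLessThan_iff
          less_eq_real_def real_sqrt_unique)
    then show ?thesis
      using q_pos[of "h z"] h_interior[OF z] by (simp add: Pq real_sqrt_mult)
  qed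
  from travel_time_integral[OF q_cont q_pos h_cont h_0 h_1 h_interior h_deriv this]
  show ?thesis
    using quad_node_limit[OF q_cont q_pos Pq] by simp
qed

end

section \<open>The sine-squared nodes and the proof of the theorem\<close>

lemma node_0: "node N 0 = 0"
  by (simp add: node_def)

lemma node_N: "N > 0 \<Longrightarrow> node N N = 1"
  by (simp add: node_def)

lemma node_less:
  assumes "i < j" "j \<le> N"
  shows "node N i < node N j"
proof -
  have "0 \<le> pi * real i / (2 * real N)" "pi * real i / (2 * real N) < pi * real j / (2 * real N)"
    "pi * real j / (2 * real N) \<le> pi / 2"
    using assms by (auto simp: field_simps)
  then show ?thesis
    unfolding node_def using pi_gt_zero
    by (intro power_strict_mono sin_monotone_2pi sin_ge_zero) linarith+
qed

lemma node_range: "j \<le> N \<Longrightarrow> node N j \<in> {0..1}"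
  by (simp add: node_def abs_square_le_1)

text \<open>A function with zero second derivative is affine, hence zero once both end values
  vanish. It is applied to \<open>\<psi> lam - P lam\<close>.\<close>

lemma boundary_value_unique:
  fixes f g k :: "real \<Rightarrow> real"
  assumes f: "\<And>x. x \<in> {0..1} \<Longrightarrow> (f has_real_derivative g x) (at x within {0..1})"
    and g: "\<And>x. x \<in> {0..1} \<Longrightarrow> (g has_real_derivative 0) (at x within {0..1})"
    and b: "f 0 = 0" "f 1 = 0" and x: "x \<in> {0..1}"
  shows "f x = 0"
proof -
  obtain c where c: "\<And>x. x \<in> {0..1} \<Longrightarrow> g x = c"
    using has_field_derivative_zero_constant[of "{0..1}" g] g by (auto simp: convex_real_interval)
  have "((\<lambda>x. f x - c * x) has_real_derivative 0) (at x within {0..1})" if "x \<in> {0..1}" for x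
    using f[OF that] c[OF that] by (auto intro!: derivative_eq_intros)
  then obtain d where d: "\<And>x. x \<in> {0..1} \<Longrightarrow> f x - c * x = d"
    using has_field_derivative_zero_constant[of "{0..1}" "\<lambda>x. f x - c * x"] by (auto simp: convex_real_interval)
  show ?thesis
    using d[of 0] d[of 1] d[OF x] b by simp
qed

theorem theorem5p1:
  fixes Sig :: "real \<Rightarrow> real" and Sig_min :: real and \<psi> :: "real \<Rightarrow> real \<Rightarrow> real"
  assumes "continuous_on {0..1} Sig"
    and "Sig_min > 0"
    and "\<And>h. h \<in> {0..1} \<Longrightarrow> Sig h \<ge> Sig_min"
    and "\<And>lam. lam > 0 \<Longrightarrow> solves_psi Sig lam (\<psi> lam)"
  shows "(\<forall>N\<ge>2. \<exists>!lam. discrete_solution \<psi> N lam) \<and>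
    (\<forall>lam_star h_star \<phi>_star. coupled_solution Sig lam_star h_star \<phi>_star \<longrightarrow>
       (\<lambda>N. THE lam. discrete_solution \<psi> N lam) \<longlonglongrightarrow> lam_star)"
proof -
  have "\<exists>D. \<forall>h\<in>{0..1}. (\<psi> lam has_real_derivative D h) (at h within {0..1}) \<and>
      (D has_real_derivative (2 - 2 * lam * Sig h)) (at h within {0..1})" if "lam > 0" for lam
    using assms(4)[OF that] by (simp add: solves_psi_def)
  then obtain D where D:
    "\<And>lam h. lam > 0 \<Longrightarrow> h \<in> {0..1} \<Longrightarrow> (\<psi> lam has_real_derivative D lam h) (at h within {0..1})"
    "\<And>lam h. lam > 0 \<Longrightarrow> h \<in> {0..1} \<Longrightarrow>
      (D lam has_real_derivative (2 - 2 * lam * Sig h)) (at h within {0..1})"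
    by metis
  have bdry: "\<psi> lam 0 = 0" "\<psi> lam 1 = 0" if "lam > 0" for lam
    using assms(4)[OF that] by (auto simp: solves_psi_def)
  \<comment> \<open>The difference of the solutions for \<open>2\<close> and \<open>1\<close> has
    second derivative \<open>- 2 * Sig\<close> and zero boundary values, so it can serve as
    \<open>G\<close>.\<close>
  interpret string_data Sig "\<lambda>h. \<psi> 2 h - \<psi> 1 h" "\<lambda>h. D 2 h - D 1 h"
  proof
    show "Sig h > 0" if "h \<in> {0..1}" for h
      using assms(2) assms(3)[OF that] by linarith
    show "((\<lambda>h. \<psi> 2 h - \<psi> 1 h) has_real_derivative D 2 h - D 1 h) (at h within {0..1})"
      if "h \<in> {0..1}" for h
      using that by (intro DERIV_diff D) auto
    show "((\<lambda>h. D 2 h - D 1 h) has_real_derivative - 2 * Sig h) (at h within {0..1})"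
      if "h \<in> {0..1}" for h
      using DERIV_diff[OF D(2)[of 2 h] D(2)[of 1 h]] that by simp
  qed (simp_all add: bdry)
  have psi_eq: "\<psi> lam h = P lam h" if lam: "lam > 0" and h: "h \<in> {0..1}" for lam h
  proof -
    have 1: "((\<lambda>h. \<psi> lam h - P lam h) has_real_derivative
        D lam h - (lam * (D 2 h - D 1 h) - (1 - 2 * h))) (at h within {0..1})" if "h \<in> {0..1}" for h
      using DERIV_diff[OF D(1)[OF lam that] P_deriv[OF that]] .
    have 2: "((\<lambda>h. D lam h - (lam * (D 2 h - D 1 h) - (1 - 2 * h))) has_real_derivative 0)
        (at h within {0..1})" if "h \<in> {0..1}" for h
      using DERIV_diff[OF D(2)[OF lam that] P'_deriv[OF that, of lam]] by simp
    have "\<psi> lam h - P lam h = 0"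
      using boundary_value_unique[OF 1 2 _ _ h] bdry[OF lam] by simp
    then show ?thesis
      by simp
  qed
  have discrete_iff: "discrete_solution \<psi> N lam \<longleftrightarrow>
      lam > 0 \<and> admissible (P lam) (node N) N \<and> quad (P lam) (node N) N = 1" for N lam
  proof (cases "lam > 0")
    case True
    have *: "\<psi> lam (node N j) = P lam (node N j)" if "j \<le> N" for j
      using psi_eq[OF True node_range[OF that]] .
    show ?thesis
      unfolding discrete_solution_def admissible_def quad_def by (simp add: * cong: conj_cong)
  qed (simp add: discrete_solution_def)
  have scale: "quad (P mu) (node N) N \<le> sqrt (lam / mu) * quad (P lam) (node N) N"
    if "admissible (P lam) (node N) N" "admissible (P mu) (node N) N" "0 < lam" "lam \<le> mu" for N lam mu
    using that by (intro quad_P_scale node_range node_less) auto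
  have ex1: "\<exists>!lam. discrete_solution \<psi> N lam" if N: "N \<ge> 2" for N
  proof -
    have "\<exists>lam. discrete_solution \<psi> N lam"
      unfolding discrete_iff
      using quad_existence[of N "node N"] N node_less[of _ _ N] by (auto simp: node_0 node_N)
    \<comment> \<open>Two solutions \<open>lam < mu\<close> would give
      \<open>1 <= sqrt (lam / mu)\<close>, whose right side is below \<open>1\<close>.\<close>
    moreover have False
      if "discrete_solution \<psi> N lam" "discrete_solution \<psi> N mu" "lam < mu" for lam mu
      using scale[of lam N mu] that by (simp add: discrete_iff)
    ultimately show ?thesis
      by (metis linorder_neqE)
  qed
  have "(\<lambda>N. THE lam. discrete_solution \<psi> N lam) \<longlonglongrightarrow> lam_star"
    if "coupled_solution Sig lam_star h_star \<phi>_star" for lam_star h_star \<phi>_star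
  proof -
    interpret coupled Sig "\<lambda>h. \<psi> 2 h - \<psi> 1 h" "\<lambda>h. D 2 h - D 1 h" lam_star h_star \<phi>_star
      by unfold_locales (rule that)
    define q where "q N = quad (P lam_star) (node N) N" for N
    define L where "L N = (THE lam. discrete_solution \<psi> N lam)" for N
    \<comment> \<open>Scaling between \<open>lam_star\<close> and \<open>L N\<close>, from the
      smaller to the larger, puts \<open>L N\<close> between \<open>lam_star\<close> and
      \<open>lam_star * (q N)\<^sup>2\<close>.\<close>
    have "\<bar>L N - lam_star\<bar> \<le> \<bar>lam_star * (q N)\<^sup>2 - lam_star\<bar>" if N: "N \<ge> 2" for N
    proof -
      have "discrete_solution \<psi> N (L N)"
        unfolding L_def using ex1[OF N] by (rule theI')
      then have L: "L N > 0" "admissible (P (L N)) (node N) N" "quad (P (L N)) (node N) N = 1"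
        by (simp_all add: discrete_iff)
      have adm: "admissible (P lam_star) (node N) N"
        using N node_less[of 0 _ N] node_less[of _ N N]
        by (intro admissible_of_interior P_pos) (auto simp: node_0 node_N)
      have q_pos: "q N > 0"
        unfolding q_def using adm N by (intro quad_pos node_less) auto
      show ?thesis
      proof (cases "lam_star \<le> L N")
        case True
        have "1 \<le> sqrt (lam_star / L N) * q N"
          using scale[OF adm L(2) lam_pos True] by (simp add: L q_def)
        then have "1\<^sup>2 \<le> (sqrt (lam_star / L N) * q N)\<^sup>2"
          by (intro power_mono) auto
        then have "L N \<le> lam_star * (q N)\<^sup>2"
          using L(1) lam_pos by (simp add: power_mult_distrib field_simps)
        then show ?thesis
          using True by simp
      next
        case False
        then have "q N \<le> sqrt (L N / lam_star)"
          using scale[OF L(2) adm L(1)] by (simp add: L q_def)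
        then have "(q N)\<^sup>2 \<le> (sqrt (L N / lam_star))\<^sup>2"
          using q_pos by (intro power_mono) auto
        then have "lam_star * (q N)\<^sup>2 \<le> L N"
          using L(1) lam_pos by (simp add: field_simps)
        then show ?thesis
          using False by simp
      qed
    qed
    \<comment> \<open>For \<open>N < 2\<close> there is no discrete solution and \<open>THE\<close>
      is unspecified, so the bound is only eventual.\<close>
    then have "\<forall>\<^sub>F N in sequentially. norm (L N - lam_star) \<le> \<bar>lam_star * (q N)\<^sup>2 - lam_star\<bar>"
      by (auto simp: eventually_at_top_linorder)
    moreover have "q \<longlonglongrightarrow> 1"
      unfolding q_def[abs_def] by (rule quad_tendsto_1)
    then have "(\<lambda>N. \<bar>lam_star * (q N)\<^sup>2 - lam_star\<bar>) \<longlonglongrightarrow> \<bar>lam_star * 1\<^sup>2 - lam_star\<bar>"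
      by (intro tendsto_rabs tendsto_diff tendsto_mult tendsto_power tendsto_const)
    then have "(\<lambda>N. \<bar>lam_star * (q N)\<^sup>2 - lam_star\<bar>) \<longlonglongrightarrow> 0"
      by simp
    ultimately have "(\<lambda>N. L N - lam_star) \<longlonglongrightarrow> 0"
      by (rule Lim_null_comparison)
    then show ?thesis
      unfolding L_def[abs_def] by (simp add: LIM_zero_iff)
  qed
  then show ?thesis
    using ex1 by blast
qed

end
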